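(* For every complex $s$ with $\mathrm{Re}(s)>0$, $$\eta(s)=1+\sum_{n=1}^{\infty}\frac{(n-s)!}{n!\,(1-s)!}\sum_{j=2}^{\infty}(-1)^{j-1}\frac{n}{j^2}\left(1-\frac1j\right)^{n-1}.$$
   Context: $\eta(s)=\sum_{n=1}^\infty (-1)^{n+1}n^{-s}=(1-2^{1-s})\zeta(s)$ is the Dirichlet eta function. The factorial of a complex number is $x!=\Gamma(x+1)$, and the quotient $\frac{(n-s)!}{(1-s)!}$ means the polynomial $\prod_{j=2}^{n}(j-s)$ (equal to $1$ for $n=1$). *)

theory Defs
  imports "HOL-Complex_Analysis.Complex_Analysis"
begin

text \<open>The series is conditionally convergent for \<open>0 < Re s \<le> 1\<close>, so it is an ordered sum.
  Outside \<open>Re s > 0\<close> the value of this definition is irrelevant.\<close>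

definition dirichlet_eta :: "complex \<Rightarrow> complex" where
  "dirichlet_eta s = (\<Sum>k. let n = k + 1 in (-1) ^ (n + 1) * of_nat n powr (- s))"

text \<open>The quotient \<open>(n - s)! / (1 - s)!\<close>, read as a polynomial in \<open>s\<close>; thus it has no exceptional
  points at integers \<open>s \<ge> 2\<close>, where the Gamma function has poles.\<close>

definition fact_quotient :: "nat \<Rightarrow> complex \<Rightarrow> complex" where
  "fact_quotient n s = (\<Prod>j = 2..n. of_nat j - s)"

definition inner_term :: "nat \<Rightarrow> nat \<Rightarrow> real" where
  "inner_term n j = (-1) ^ (j - 1) * (real n / (real j)\<^sup>2) * (1 - 1 / real j) ^ (n - 1)"

definition outer_term :: "complex \<Rightarrow> nat \<Rightarrow> complex" where
  "outer_term s n = fact_quotient n s / fact n * of_real (\<Sum>i. inner_term n (i + 2))"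

end

theory Submission
  imports Defs
begin

text \<open>Put \<open>x = 1 - 1 / j\<close>. Since \<open>j powr -s = (1 / j\<^sup>2) * (1 - x) powr (s - 2)\<close>, the binomial series in \<open>x\<close>
  expands the \<open>j\<close>-th term of the eta series into exactly the summands of the double series
  (\<open>sums_inner_term\<close>). The theorem is therefore an interchange of the sums over \<open>j\<close> and \<open>n\<close>.

  The sum over \<open>j\<close> converges only conditionally for \<open>Re s \<le> 1\<close>, so the interchange is made for the
  partial sums over \<open>2 \<le> j < N + 2\<close>, and then \<open>N \<rightarrow> \<infinity>\<close> by Tannery's theorem, which needs a majorant
  independent of \<open>N\<close>. Two estimates give one:

  \<^item> For fixed \<open>n\<close>, the absolute values of the inner terms are \<open>n\<close> times \<open>y\<^sup>2 * (1 - y) ^ (n - 1)\<close>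
    at \<open>y = 1 / j\<close>. They rise and then fall as \<open>j\<close> grows, so every alternating partial sum is bounded
    by the largest of them, which is at most \<open>2 / (n + 1)\<close> (\<open>sum_inner_term_le\<close>). The sign
    cancellation is essential: without it the sum over \<open>j\<close> is only bounded.

  \<^item> Up to sign and a factor \<open>1 / n\<close>, the outer coefficient is the binomial coefficient of \<open>s - 2\<close> over
    \<open>n - 1\<close>. By the asymptotics of the Gamma function (\<open>gbinomial_bound\<close>) that binomial coefficient
    is \<open>O(n powr (1 - Re s))\<close>, so the outer coefficient is \<open>O(n powr - Re s)\<close>.

  The product of the two bounds is \<open>O(n powr (- Re s - 1))\<close>, which is summable precisely because
  \<open>Re s > 0\<close>.\<close>

section \<open>Alternating sums of unimodal sequences\<close>

text \<open>Splitting the sum at the peak would give the bound \<open>2 * M\<close>. Following the partial sums, normalised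
  so that the last term enters with a plus sign, gives \<open>M\<close>: while the sequence rises, they stay
  between \<open>0\<close> and the last term \<open>a N\<close>; from the peak on, they stay between \<open>a N - M\<close> and \<open>M\<close>.\<close>
lemma alternating_sum_unimodal:
  fixes a :: "nat \<Rightarrow> real"
  assumes nonneg: "\<And>i. 0 \<le> a i" and le: "\<And>i. a i \<le> M"
    and inc: "\<And>i. i + 1 < p \<Longrightarrow> a i \<le> a (i + 1)"
    and dec: "\<And>i. p \<le> i \<Longrightarrow> a (i + 1) \<le> a i"
  shows "\<bar>\<Sum>i<N. (-1) ^ i * a i\<bar> \<le> M"
proof -
  define t where "t N = (-1) ^ N * (\<Sum>i<Suc N. (-1) ^ i * a i)" for N
  have t_0: "t 0 = a 0"
    by (simp add: t_def)
  have t_Suc: "t (Suc N) = a (Suc N) - t N" for N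
    by (simp add: t_def algebra_simps flip: power_add mult_2)
  have rise: "0 \<le> t N \<and> t N \<le> a N" if "N < p" for N
    using that
  proof (induction N)
    case 0
    show ?case
      by (simp add: t_0 nonneg)
  next
    case (Suc N)
    then show ?case
      using inc[of N] by (simp add: t_Suc)
  qed
  have "a N - M \<le> t N \<and> t N \<le> M" for N
  proof (induction N)
    case 0
    show ?case
      using le[of 0] nonneg[of 0] by (simp add: t_0)
  next
    case (Suc N)
    show ?case
    proof (cases "N < p")
      case True
      then show ?thesis
        using rise[of N] le[of N] le[of "Suc N"] by (simp add: t_Suc)
    next
      case False
      then show ?thesis
        using Suc dec[of N] by (simp add: t_Suc)
    qed
  qed
  note t_bounds = this
  have "\<bar>t N\<bar> \<le> M" for N
  proof -
    have "a N - M \<le> t N" "t N \<le> M"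
      using t_bounds[of N] by auto
    then show ?thesis
      using nonneg[of N] by linarith
  qed
  then have "\<bar>\<Sum>i<Suc N. (-1) ^ i * a i\<bar> \<le> M" for N
    by (simp add: t_def abs_mult)
  moreover have "0 \<le> M"
    using nonneg[of 0] le[of 0] by linarith
  ultimately show ?thesis
    by (cases N) auto
qed

section \<open>The partial inner sums\<close>

text \<open>By the binomial theorem, \<open>((m + 2) choose 2) * y\<^sup>2 * (1 - y) ^ m\<close> is one of the nonnegative
  summands of \<open>(y + (1 - y)) ^ (m + 2) = 1\<close>.\<close>
lemma bernstein_le:
  fixes y :: real
  assumes "0 \<le> y" "y \<le> 1"
  shows "y\<^sup>2 * (1 - y) ^ m \<le> 2 / ((real m + 1) * (real m + 2))"
proof -
  have "real ((m + 2) choose 2) * y\<^sup>2 * (1 - y) ^ m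
      \<le> (\<Sum>k\<le>m + 2. real ((m + 2) choose k) * y ^ k * (1 - y) ^ (m + 2 - k))"
    using assms by (intro order_trans[OF _ member_le_sum[where i = 2]]) auto
  also have "\<dots> = (y + (1 - y)) ^ (m + 2)"
    by (rule binomial_ring[symmetric])
  also have "\<dots> = 1"
    by simp
  also have "real ((m + 2) choose 2) = (real m + 1) * (real m + 2) / 2"
    by (simp add: gbinomial_pochhammer' binomial_gbinomial numeral_2_eq_2 pochhammer_Suc field_simps)
  finally have "y\<^sup>2 * (1 - y) ^ m * ((real m + 1) * (real m + 2)) \<le> 2"
    by (simp add: mult_ac)
  then show ?thesis
    by (subst pos_le_divide_eq) auto
qed

lemma bernstein_has_derivative:
  fixes y :: real
  shows "((\<lambda>y. y\<^sup>2 * (1 - y) ^ Suc m) has_real_derivative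
           y * (1 - y) ^ m * (2 - (real m + 3) * y)) (at y)"
proof -
  have "((\<lambda>y. y\<^sup>2 * (1 - y) ^ Suc m) has_real_derivative
           2 * y * (1 - y) ^ Suc m - y\<^sup>2 * (real (Suc m) * (1 - y) ^ m)) (at y)"
    by (auto intro!: derivative_eq_intros simp del: power_Suc of_nat_Suc)
  also have "2 * y * (1 - y) ^ Suc m - y\<^sup>2 * (real (Suc m) * (1 - y) ^ m)
           = y * (1 - y) ^ m * (2 - (real m + 3) * y)"
    by (simp add: algebra_simps power2_eq_square)
  finally show ?thesis .
qed

lemma bernstein_mono:
  fixes x y :: real
  assumes "0 \<le> x" "x \<le> y" "y \<le> 1" "(real m + 2) * y \<le> 2"
  shows "x\<^sup>2 * (1 - x) ^ m \<le> y\<^sup>2 * (1 - y) ^ m"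
proof (cases m)
  case 0
  then show ?thesis
    using assms by (simp add: power_mono)
next
  case (Suc k)
  show ?thesis
    unfolding Suc
  proof (rule DERIV_nonneg_imp_nondecreasing[OF \<open>x \<le> y\<close>], intro exI conjI)
    fix z assume z: "x \<le> z" "z \<le> y"
    have "(real k + 3) * z \<le> (real k + 3) * y"
      using z by (intro mult_left_mono) auto
    then show "0 \<le> z * (1 - z) ^ k * (2 - (real k + 3) * z)"
      using assms z Suc by (intro mult_nonneg_nonneg zero_le_power) (auto simp: algebra_simps)
  qed (rule bernstein_has_derivative)
qed

lemma bernstein_antimono:
  fixes x y :: real
  assumes "0 \<le> x" "x \<le> y" "y \<le> 1" "(real m + 2) * x \<ge> 2"
  shows "y\<^sup>2 * (1 - y) ^ m \<le> x\<^sup>2 * (1 - x) ^ m"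
proof (cases m)
  case 0
  then show ?thesis
    using assms by simp
next
  case (Suc k)
  show ?thesis
    unfolding Suc
  proof (rule DERIV_nonpos_imp_nonincreasing[OF \<open>x \<le> y\<close>], intro exI conjI)
    fix z assume z: "x \<le> z" "z \<le> y"
    have "(real k + 3) * x \<le> (real k + 3) * z"
      using z by (intro mult_left_mono) auto
    then show "z * (1 - z) ^ k * (2 - (real k + 3) * z) \<le> 0"
      using assms z Suc
      by (intro mult_nonneg_nonpos mult_nonneg_nonneg zero_le_power) (auto simp: algebra_simps)
  qed (rule bernstein_has_derivative)
qed

text \<open>The index \<open>m = n - 1\<close> avoids truncated subtraction, and \<open>i = j - 2\<close> is the summation index of the
  inner series.\<close>
lemma inner_term_eq:
  "inner_term (Suc m) (i + 2) =
     - ((real m + 1) * ((-1) ^ i * ((1 / (real i + 2))\<^sup>2 * (1 - 1 / (real i + 2)) ^ m)))"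
  by (simp add: inner_term_def power_divide add_ac)

text \<open>The unimodality in \<open>j\<close> is that of \<open>y\<^sup>2 * (1 - y) ^ m\<close> in \<open>y = 1 / j\<close>, whose maximum on the unit
  interval is at \<open>y = 2 / (m + 2)\<close>. The bound is uniform in \<open>N\<close>, as Tannery's theorem requires.\<close>
lemma sum_inner_term_le:
  "\<bar>\<Sum>i<N. inner_term (Suc m) (i + 2)\<bar> \<le> 2 / (real m + 2)"
proof -
  define y where "y i = 1 / (real i + 2)" for i
  have y: "0 \<le> y i" "y i \<le> 1" "y (i + 1) \<le> y i" for i
    by (auto simp: y_def field_simps)
  have "\<bar>\<Sum>i<N. (-1) ^ i * ((y i)\<^sup>2 * (1 - y i) ^ m)\<bar> \<le> 2 / ((real m + 1) * (real m + 2))"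
    \<comment> \<open>\<open>m div 2\<close> is an index from which on \<open>y i \<le> 2 / (m + 2)\<close>, i.e. \<open>m + 2 \<le> 2 * (i + 2)\<close>,
      while \<open>y (i + 1) \<ge> 2 / (m + 2)\<close> as long as \<open>i + 1 < m div 2\<close>.\<close>
  proof (rule alternating_sum_unimodal[where p = "m div 2"])
    fix i assume "i + 1 < m div 2"
    then have "2 * (i + 3) \<le> m + 2"
      by presburger
    then have "real (2 * (i + 3)) \<le> real (m + 2)"
      by (rule of_nat_mono)
    then have "2 \<le> (real m + 2) * y (i + 1)"
      by (simp add: y_def field_simps)
    then show "(y i)\<^sup>2 * (1 - y i) ^ m \<le> (y (i + 1))\<^sup>2 * (1 - y (i + 1)) ^ m"
      using y by (intro bernstein_antimono) auto
  next
    fix i assume "m div 2 \<le> i"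
    then have "m + 2 \<le> 2 * (i + 2)"
      by presburger
    then have "real (m + 2) \<le> real (2 * (i + 2))"
      by (rule of_nat_mono)
    then have "(real m + 2) * y i \<le> 2"
      by (simp add: y_def field_simps)
    then show "(y (i + 1))\<^sup>2 * (1 - y (i + 1)) ^ m \<le> (y i)\<^sup>2 * (1 - y i) ^ m"
      using y by (intro bernstein_mono) auto
  qed (use y bernstein_le in auto)
  then have "(real m + 1) * \<bar>\<Sum>i<N. (-1) ^ i * ((y i)\<^sup>2 * (1 - y i) ^ m)\<bar> \<le> (real m + 1) * (2 / ((real m + 1) * (real m + 2)))"
    by (intro mult_left_mono) auto
  also have "\<dots> = 2 / (real m + 2)"
    by (simp add: divide_simps)
  finally have "(real m + 1) * \<bar>\<Sum>i<N. (-1) ^ i * ((y i)\<^sup>2 * (1 - y i) ^ m)\<bar> \<le> 2 / (real m + 2)" .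
  moreover have "(\<Sum>i<N. inner_term (Suc m) (i + 2)) =
      - ((real m + 1) * (\<Sum>i<N. (-1) ^ i * ((y i)\<^sup>2 * (1 - y i) ^ m)))"
    by (simp only: inner_term_eq y_def sum_distrib_left sum_negf)
  ultimately show ?thesis
    by (simp add: abs_mult)
qed

lemma summable_inner_term: "summable (\<lambda>i. inner_term n (i + 2))"
proof (rule summable_comparison_test')
  have "summable (\<lambda>i. 1 / real i ^ 2)"
    using inverse_power_summable[of 2, where 'a = real] by (simp add: inverse_eq_divide)
  then show "summable (\<lambda>i. real n * (1 / real (i + 2) ^ 2))"
    by (intro summable_mult summable_ignore_initial_segment)
  fix i :: nat
  have "(1 - 1 / (real i + 2)) ^ (n - 1) \<le> 1"
    by (intro power_le_one) (auto simp: field_simps)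
  then have "(real n / (real i + 2)\<^sup>2) * \<bar>(1 - 1 / (real i + 2)) ^ (n - 1)\<bar>
      \<le> (real n / (real i + 2)\<^sup>2) * 1"
    by (intro mult_left_mono) (auto simp: field_simps)
  then show "norm (inner_term n (i + 2)) \<le> real n * (1 / real (i + 2) ^ 2)"
    by (simp add: inner_term_def abs_mult add_ac)
qed

section \<open>The outer coefficients\<close>

lemma fact_quotient_eq_gbinomial:
  "fact_quotient (Suc m) s / fact (Suc m) = (-1) ^ m * ((s - 2) gchoose m) / of_nat (Suc m)"
proof -
  have "fact_quotient (Suc m) s = pochhammer (2 - s) m"
  proof (induction m)
    case 0
    show ?case by (simp add: fact_quotient_def)
  next
    case (Suc m)
    then show ?case
      by (simp add: fact_quotient_def pochhammer_Suc prod.nat_ivl_Suc' algebra_simps)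
  qed
  then show ?thesis
    by (simp add: gbinomial_pochhammer field_simps)
qed

text \<open>The quotient of \<open>a gchoose m\<close> by \<open>(-1) ^ m * m powr (- a - 1)\<close> converges, by Gauss's limit formula for \<open>1 / Gamma (- a)\<close>; hence it
  is bounded.\<close>
lemma gbinomial_bound:
  fixes a :: complex
  obtains K where "\<And>m. m > 0 \<Longrightarrow> norm (a gchoose m) \<le> K * real m powr (- Re a - 1)"
proof -
  obtain K where K: "\<And>m. norm ((a gchoose m) / ((-1)^m / exp ((a + 1) * of_real (ln (real m))))) \<le> K"
    using convergent_imp_Bseq[OF convergentI[OF gbinomial_asymptotic[of a]]]
    by (auto simp: Bseq_def)
  show ?thesis
  proof (rule that[of K])
    fix m :: nat assume m: "m > 0"
    have "norm (a gchoose m) * real m powr (Re a + 1) \<le> K"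
      using K[of m] m by (simp add: norm_divide norm_mult norm_power powr_def algebra_simps)
    then have "norm (a gchoose m) \<le> K / real m powr (Re a + 1)"
      using m by (subst pos_le_divide_eq) auto
    also have "\<dots> = K * real m powr (- (Re a + 1))"
      by (simp only: powr_minus divide_inverse)
    finally show "norm (a gchoose m) \<le> K * real m powr (- Re a - 1)"
      by simp
  qed
qed

section \<open>Expanding the eta series\<close>

text \<open>The binomial series of exponent \<open>s - 2\<close> at \<open>-(1 - 1 / j)\<close>. The exponent is \<open>s - 2\<close> rather than \<open>s\<close>
  because the factor \<open>1 / j\<^sup>2\<close> is kept outside; this is what makes the coefficients start with the
  factor \<open>2 - s\<close>.\<close>
lemma sums_inner_term:
  assumes j: "j > 0"
  shows "(\<lambda>m. fact_quotient (Suc m) s / fact (Suc m) * of_real (inner_term (Suc m) j))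
           sums ((-1) ^ (j - 1) * of_nat j powr (- s))"
proof -
  have "norm (- of_real (1 - 1 / real j) :: complex) < 1"
    using j by (simp only: norm_minus_cancel norm_of_real) (auto simp: field_simps)
  then have "(\<lambda>m. ((s - 2) gchoose m) * (- of_real (1 - 1 / real j)) ^ m) sums
      (1 + - of_real (1 - 1 / real j)) powr (s - 2)"
    by (rule gen_binomial_complex)
  then have "(\<lambda>m. ((-1) ^ (j - 1) / of_nat j ^ 2) * (((s - 2) gchoose m) * (- of_real (1 - 1 / real j)) ^ m))
      sums (((-1) ^ (j - 1) / of_nat j ^ 2) * (1 + - of_real (1 - 1 / real j)) powr (s - 2))"
    by (rule sums_mult)
  moreover have "((-1) ^ (j - 1) / of_nat j ^ 2) * (((s - 2) gchoose m) * (- of_real (1 - 1 / real j)) ^ m)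
      = fact_quotient (Suc m) s / fact (Suc m) * of_real (inner_term (Suc m) j)" for m
  proof -
    have "(- of_real (1 - 1 / real j)) ^ m = (-1) ^ m * (of_real (1 - 1 / real j) :: complex) ^ m"
      by (rule power_minus)
    then show ?thesis
      unfolding fact_quotient_eq_gbinomial
      by (simp add: inner_term_def field_simps del: of_real_diff of_nat_Suc)
  qed
  moreover have "((-1) ^ (j - 1) / of_nat j ^ 2) * (1 + - of_real (1 - 1 / real j)) powr (s - 2)
      = (-1) ^ (j - 1) * (of_nat j :: complex) powr (- s)"
  proof -
    have "(1 + - of_real (1 - 1 / real j)) powr (s - 2) = of_real (1 / real j) powr (s - 2)"
      by simp
    also have "\<dots> = of_nat j powr (2 - s)"
    proof -
      have "Ln (of_real (1 / real j)) = - Ln (of_nat j)"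
        using j by (subst Ln_of_real) (auto simp: Ln_of_nat ln_div)
      then show ?thesis
        using j by (simp add: powr_def algebra_simps)
    qed
    also have "\<dots> = of_nat j ^ 2 * of_nat j powr (- s)"
      using j powr_add[of "of_nat j :: complex" 2 "- s"] by (simp add: powr_numeral)
    finally show ?thesis
      using j by simp
  qed
  ultimately show ?thesis
    by simp
qed

theorem mainTheorem3:
  fixes s :: complex
  assumes "Re s > 0"
  shows "(\<forall>n\<ge>1. summable (\<lambda>i. inner_term n (i + 2)))
    \<and> summable (\<lambda>k. outer_term s (k + 1))
    \<and> dirichlet_eta s = 1 + (\<Sum>k. outer_term s (k + 1))"
proof -
  define c where "c m = fact_quotient (Suc m) s / fact (Suc m)" for m
  define B where "B m N = (\<Sum>i<N. inner_term (Suc m) (i + 2))" for m N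
  obtain K where K: "\<And>m. m > 0 \<Longrightarrow> norm ((s - 2) gchoose m) \<le> K * real m powr (- Re (s - 2) - 1)"
    using gbinomial_bound by blast
  have bound: "norm (c m * of_real (B m N)) \<le> 2 * K * real m powr (- Re s - 1)" if m: "m > 0" for m N
  proof -
    have "norm (c m * of_real (B m N)) = norm ((s - 2) gchoose m) / real (Suc m) * \<bar>B m N\<bar>"
      unfolding c_def fact_quotient_eq_gbinomial
      by (simp add: norm_mult norm_divide norm_power del: of_nat_Suc)
    also have "\<dots> \<le> norm ((s - 2) gchoose m) / real (Suc m) * (2 / (real m + 2))"
      unfolding B_def by (intro mult_left_mono sum_inner_term_le) auto
    also have "\<dots> \<le> norm ((s - 2) gchoose m) / real m * (2 / real m)"
      using m by (intro mult_mono divide_left_mono) auto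
    also have "\<dots> = 2 * norm ((s - 2) gchoose m) * real m powr -2"
      using m by (simp add: powr_minus powr_numeral divide_inverse power2_eq_square)
    also have "\<dots> \<le> 2 * (K * real m powr (- Re (s - 2) - 1)) * real m powr -2"
      using K[OF m] by (intro mult_right_mono mult_left_mono) auto
    also have "\<dots> = 2 * K * real m powr (- Re s - 1)"
    proof -
      have "real m powr (- Re (s - 2) - 1) * real m powr -2 = real m powr (- Re s - 1)"
        by (subst powr_add[symmetric], intro arg_cong2[where f = "(powr)"]) simp_all
      then show ?thesis
        by (simp only: mult.assoc)
    qed
    finally show ?thesis .
  qed
  have tannery: "summable (\<lambda>m. norm (c m * of_real (\<Sum>i. inner_term (Suc m) (i + 2)))) \<and>
      ((\<lambda>N. \<Sum>m. c m * of_real (B m N)) \<longlonglongrightarrow> (\<Sum>m. c m * of_real (\<Sum>i. inner_term (Suc m) (i + 2))))"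
  proof -
    have M: "summable (\<lambda>m. 2 * K * real m powr (- Re s - 1))"
      using assms by (intro summable_mult) (simp add: summable_real_powr_iff)
    have lim: "(\<lambda>N. c m * of_real (B m N)) \<longlonglongrightarrow> c m * of_real (\<Sum>i. inner_term (Suc m) (i + 2))" for m
      unfolding B_def by (intro tendsto_intros summable_LIMSEQ summable_inner_term)
    have bd: "\<forall>\<^sub>F (m, N) in at_top \<times>\<^sub>F sequentially.
        norm (c m * of_real (B m N)) \<le> 2 * K * real m powr (- Re s - 1)"
      unfolding eventually_prod_sequentially by (intro exI[of _ 1]) (simp add: bound)
    show ?thesis
      by (rule conjunct2[OF tannerys_theorem[OF lim bd M sequentially_bot]])
  qed
  have outer: "outer_term s (m + 1) = c m * of_real (\<Sum>i. inner_term (Suc m) (i + 2))" for m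
    by (simp add: outer_term_def c_def)
  define e where "e k = (let n = k + 1 in (-1) ^ (n + 1) * (of_nat n :: complex) powr (- s))" for k
  \<comment> \<open>Only finitely many series are added here, so this interchange needs no convergence argument.
    The term \<open>e 0\<close> belongs to \<open>j = 1\<close> and supplies the summand \<open>1\<close>.\<close>
  have partial: "(\<Sum>k<Suc N. e k) = 1 + (\<Sum>m. c m * of_real (B m N))" for N
  proof -
    have "(\<lambda>m. \<Sum>i<N. c m * of_real (inner_term (Suc m) (i + 2))) sums
        (\<Sum>i<N. (-1) ^ (i + 2 - 1) * of_nat (i + 2) powr (- s))"
      unfolding c_def by (intro sums_sum sums_inner_term) auto
    also have "(\<Sum>i<N. (-1) ^ (i + 2 - 1) * of_nat (i + 2) powr (- s)) = (\<Sum>i<N. e (Suc i))"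
      by (simp add: e_def Let_def)
    finally have "(\<Sum>i<N. e (Suc i)) = (\<Sum>m. c m * of_real (B m N))"
      by (simp add: sums_iff B_def sum_distrib_left)
    moreover have "e 0 = 1"
      by (simp add: e_def)
    ultimately show ?thesis
      by (simp add: sum.lessThan_Suc_shift del: sum.lessThan_Suc)
  qed
  have "e sums (1 + (\<Sum>m. outer_term s (m + 1)))"
    unfolding sums_def
  proof (rule LIMSEQ_imp_Suc)
    show "(\<lambda>N. \<Sum>k<Suc N. e k) \<longlonglongrightarrow> 1 + (\<Sum>m. outer_term s (m + 1))"
      unfolding partial outer using tannery by (intro tendsto_intros) auto
  qed
  then have "dirichlet_eta s = 1 + (\<Sum>m. outer_term s (m + 1))"
    by (simp add: dirichlet_eta_def e_def[abs_def] sums_iff)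
  moreover have "summable (\<lambda>m. outer_term s (m + 1))"
    unfolding outer by (rule summable_norm_cancel[OF conjunct1[OF tannery]])
  ultimately show ?thesis
    using summable_inner_term by simp
qed

end
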